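(* Let $\mu$ be an absolutely continuous measure on $\mathbb{T}$ (with respect to $m$) with density $\mu'=\frac{d\mu}{dm}>0$ $m$-a.e. and with divergent logarithmic integral $$\int_{\mathbb{T}}\log\mu'\,dm=-\infty .$$ Then, for any sequence of positive numbers $\varepsilon_n\to 0$, there exists a positive measurable function $w$ on $\mathbb{T}$ such that $w\mu$ is a finite measure, $\log w\in L^p(m)$ for every $p<\infty$, and $$\frac{e_n(w\mu)}{\varepsilon_n}\to\infty\qquad\text{as } n\to\infty .$$
   Context: $\mathbb{T}$ is the unit circle and $m$ is the normalized Lebesgue measure on $\mathbb{T}$ ($m(\mathbb{T})=1$). "Measure on $\mathbb{T}$" means finite positive Borel measure. For such a measure $\rho$ and an integer $n\ge 0$, $e_n(\rho)\ge 0$ is defined by $$e_n(\rho)^2=\min_{q_0,\dots,q_{n-1}\in\mathbb{C}}\int_{\mathbb{T}}\bigl|t^n+q_{n-1}t^{n-1}+\dots+q_1t+q_0\bigr|^2\,d\rho(t).$$ $w\mu$ denotes the measure with density $w$ with respect to $\mu$. *)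

theory Defs
  imports "HOL-Probability.Probability"
begin

definition circle :: "complex set" where
  "circle = sphere 0 1"

text \<open>The image of the uniform distribution on \<open>[0,1)\<close> under
  \<open>x \<mapsto> exp (2 \<pi> i x)\<close>, as a measure on the Borel sets of the circle.\<close>

definition circle_measure :: "complex measure" where
  "circle_measure =
     distr (uniform_measure lborel {0..<1::real}) (restrict_space borel circle)
       (\<lambda>x. cis (2 * pi * x))"

text \<open>A real function has Lebesgue integral \<open>- \<infinity>\<close> if its positive part is
  integrable and its negative part is not; \<open>ennreal\<close> truncates negative values to \<open>0\<close>.\<close>

definition integral_is_minus_infinity :: "'a measure \<Rightarrow> ('a \<Rightarrow> real) \<Rightarrow> bool" where
  "integral_is_minus_infinity M g \<longleftrightarrow>
     g \<in> borel_measurable M \<and>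
     (\<integral>\<^sup>+ x. ennreal (g x) \<partial>M) < \<infinity> \<and>
     (\<integral>\<^sup>+ x. ennreal (- g x) \<partial>M) = \<infinity>"

text \<open>Only the values \<open>q 0, \<dots>, q (n - 1)\<close> enter. For a finite measure \<open>\<rho>\<close> on the circle
  the infimum is a minimum: it is the squared distance in \<open>L\<^sup>2(\<rho>)\<close> from the \<open>n\<close>-th power
  to a finite-dimensional subspace.\<close>

definition e_n :: "nat \<Rightarrow> complex measure \<Rightarrow> real" where
  "e_n n \<rho> =
     sqrt (INF q :: nat \<Rightarrow> complex. \<integral>t. (cmod (t ^ n + (\<Sum>k<n. q k * t ^ k)))\<^sup>2 \<partial>\<rho>)"

lemma space_circle_measure [simp]: "space circle_measure = circle"
  by (simp add: circle_measure_def space_restrict_space)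

lemma sets_circle_measure [simp, measurable_cong]:
  "sets circle_measure = sets (restrict_space borel circle)"
  by (simp add: circle_measure_def)

lemma prob_space_circle_measure: "prob_space circle_measure"
proof -
  have "prob_space (uniform_measure lborel {0..<1::real})"
    by (rule prob_space_uniform_measure) simp_all
  moreover have "(\<lambda>x. cis (2 * pi * x)) \<in>
      measurable (uniform_measure lborel {0..<1::real}) (restrict_space borel circle)"
    by (rule measurable_restrict_space2)
       (auto simp: circle_def cis_conv_exp intro!: borel_measurable_continuous_onI continuous_intros)
  ultimately show ?thesis
    unfolding circle_measure_def by (rule prob_space.prob_space_distr)
qed

end

theory Submission
  imports Defs
begin

text \<open>
  Fix a degree bound \<open>N\<close>, let \<open>K = N + 1\<close>, and let \<open>E = {f \<ge> \<delta>}\<close> with \<open>\<delta>\<close> so small that the complement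
  of \<open>E\<close> has measure at most \<open>1/(2K)\<close>. Split the circle into the sets \<open>U\<^sub>l\<close>, \<open>l < L\<close>, where \<open>t\<^sup>K\<close> lies
  in the \<open>l\<close>-th of \<open>L\<close> equal arcs. As \<open>U\<^sub>l\<close> is invariant under the \<open>K\<close>-th roots of unity, the
  powers \<open>t\<^sup>j\<close> with \<open>j < K\<close> are orthogonal on it, so the average of \<open>|P|\<^sup>2\<close> over \<open>U\<^sub>l\<close> is exactly its
  average over the circle, for every polynomial \<open>P\<close> of degree less than \<open>K\<close>. By pigeonhole some \<open>U\<^sub>l\<close> loses
  at most the fraction \<open>1/(2K)\<close> outside \<open>E\<close>; since \<open>|P|\<^sup>2\<close> is at most \<open>K\<close> times its average, the set
  \<open>B = U\<^sub>l \<inter> E\<close>, of measure at most \<open>1/L\<close>, still sees half of the norm of \<open>P\<close>. Here \<open>L\<close> is chosen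
  after \<open>\<delta>\<close>, so \<open>B\<close> can be made so small that powers of \<open>ln (L/\<delta>)\<close> have tiny integral over \<open>B\<close>.

  Carrying this out for degree bounds \<open>N\<^sub>k\<close> that grow so fast that \<open>\<epsilon>\<^sub>n \<le> 2\<^bsup>-(k+1)\<^esup>\<close> for \<open>n \<ge> N\<^sub>k\<close>, let \<open>w\<close> be the
  maximum of \<open>1\<close> and of the functions \<open>2\<^bsup>-k\<^esup> L\<^sub>k / f\<close> on \<open>B\<^sub>k\<close>. The extra mass is at most \<open>\<Sum> 2\<^bsup>-k\<^esup>\<close>, while
  \<open>e\<^sub>n\<^sup>2 \<ge> 2\<^bsup>-k\<^esup>/2\<close> for \<open>n < N\<^sub>k\<close>, which dominates \<open>\<epsilon>\<^sub>n\<^sup>2 \<le> 4\<^bsup>-k\<^esup>\<close> for \<open>N\<^bsub>k-1\<^esub> \<le> n < N\<^sub>k\<close>.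
\<close>

section \<open>Rotation invariance of the normalized Lebesgue measure on the circle\<close>

lemma sets_circle_measure_iff: "A \<in> sets circle_measure \<longleftrightarrow> A \<in> sets borel \<and> A \<subseteq> circle"
  unfolding sets_circle_measure by (subst sets_restrict_space_iff) (auto simp: circle_def)

lemma norm_circle [simp]: "t \<in> circle \<Longrightarrow> cmod t = 1"
  by (simp add: circle_def)

lemma emeasure_circle_measure:
  assumes "A \<in> sets circle_measure"
  shows "emeasure circle_measure A =
    (\<integral>\<^sup>+ x. indicator A (cis (2 * pi * x)) * indicator {0..<1::real} x \<partial>lborel)"
proof -
  have A [measurable]: "A \<in> sets borel" and sub: "A \<subseteq> circle"
    using assms unfolding sets_circle_measure_iff by blast+
  have m: "(\<lambda>x. cis (2 * pi * x)) \<in>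
      measurable (uniform_measure lborel {0..<1::real}) (restrict_space borel circle)"
    by (rule measurable_restrict_space2)
       (auto simp: circle_def cis_conv_exp intro!: borel_measurable_continuous_onI continuous_intros)
  have cis [measurable]: "(\<lambda>x. cis (2 * pi * x)) \<in> borel_measurable borel"
    by (auto simp: cis_conv_exp intro!: borel_measurable_continuous_onI continuous_intros)
  have "emeasure circle_measure A = (\<integral>\<^sup>+ t. indicator A t \<partial>circle_measure)"
    using assms by simp
  also have "\<dots> = (\<integral>\<^sup>+ x. indicator A (cis (2 * pi * x)) \<partial>uniform_measure lborel {0..<1::real})"
    unfolding circle_measure_def using assms
    by (intro nn_integral_distr m) (auto simp: circle_measure_def)
  also have "\<dots> = (\<integral>\<^sup>+ x. indicator A (cis (2 * pi * x)) * indicator {0..<1::real} x \<partial>lborel)"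
    by (subst nn_integral_uniform_measure) (auto simp: divide_ennreal_def)
  finally show ?thesis .
qed

lemma circle_cisE:
  assumes "c \<in> circle"
  obtains s where "0 \<le> s" "s < 1" "c = cis (2 * pi * s)"
proof
  have "c = exp (\<i> * of_real (Arg2pi c))"
    using assms complex_norm_eq_1_exp[of c] by simp
  then show "c = cis (2 * pi * (Arg2pi c / (2 * pi)))"
    by (simp add: cis_conv_exp)
qed (use Arg2pi[of c] in \<open>auto simp: field_simps\<close>)

lemma measurable_circle_rotation:
  assumes "c \<in> circle"
  shows "(*) c \<in> measurable circle_measure circle_measure"
  unfolding measurable_cong_sets[OF sets_circle_measure sets_circle_measure]
  by (rule measurable_restrict_space3) (use assms in \<open>auto simp: circle_def norm_mult\<close>)

text \<open>Rotation by \<open>cis (2 * pi * s)\<close> shifts the parameter by \<open>s\<close>, so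
  \<open>[0, 1)\<close> becomes \<open>[s, s + 1)\<close>; the piece beyond \<open>1\<close> is
  brought back by the 1-periodicity of \<open>h\<close>.\<close>

lemma emeasure_circle_rotation:
  assumes c: "c \<in> circle" and A: "A \<in> sets circle_measure"
  shows "emeasure circle_measure {t \<in> circle. c * t \<in> A} = emeasure circle_measure A"
proof -
  obtain s where s: "0 \<le> s" "s < 1" "c = cis (2 * pi * s)"
    using c by (rule circle_cisE)
  have [measurable]: "A \<in> sets borel"
    using A unfolding sets_circle_measure_iff by blast
  have cis [measurable]: "(\<lambda>x. cis (2 * pi * x)) \<in> borel_measurable borel"
    by (auto simp: cis_conv_exp intro!: borel_measurable_continuous_onI continuous_intros)
  define h :: "real \<Rightarrow> ennreal" where "h x = indicator A (cis (2 * pi * x))" for x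
  have [measurable]: "h \<in> borel_measurable borel"
    unfolding h_def by measurable
  have per: "h (1 + x) = h x" for x
    by (simp add: h_def distrib_left flip: cis_mult)
  have B: "{t \<in> circle. c * t \<in> A} \<in> sets circle_measure"
    using measurable_sets[OF measurable_circle_rotation[OF c] A]
    by (simp add: vimage_def Int_def conj_commute)
  have "emeasure circle_measure {t \<in> circle. c * t \<in> A} =
      (\<integral>\<^sup>+ x. h (s + x) * indicator {0..<1::real} x \<partial>lborel)"
    unfolding emeasure_circle_measure[OF B] h_def
    by (intro nn_integral_cong) (auto simp: s distrib_left indicator_def circle_def cis_mult)
  also have "\<dots> = (\<integral>\<^sup>+ x. h x * indicator {s..<s+1} x \<partial>lborel)"
    by (subst nn_integral_real_affine[of "\<lambda>x. h x * indicator {s..<s+1} x" 1 s])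
       (auto intro!: nn_integral_cong simp: indicator_def)
  also have "\<dots> = (\<integral>\<^sup>+ x. h x * indicator {s..<1} x + h x * indicator {1..<s+1} x \<partial>lborel)"
    using s by (intro nn_integral_cong) (auto simp: indicator_def)
  also have "\<dots> = (\<integral>\<^sup>+ x. h x * indicator {s..<1} x \<partial>lborel) + (\<integral>\<^sup>+ x. h x * indicator {1..<s+1} x \<partial>lborel)"
    by (rule nn_integral_add) auto
  also have "(\<integral>\<^sup>+ x. h x * indicator {1..<s+1} x \<partial>lborel) = (\<integral>\<^sup>+ x. h x * indicator {0..<s} x \<partial>lborel)"
    by (subst nn_integral_real_affine[of "\<lambda>x. h x * indicator {1..<s+1} x" 1 1])
       (auto intro!: nn_integral_cong simp: indicator_def per)
  also have "(\<integral>\<^sup>+ x. h x * indicator {s..<1} x \<partial>lborel) + (\<integral>\<^sup>+ x. h x * indicator {0..<s} x \<partial>lborel)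
      = (\<integral>\<^sup>+ x. h x * indicator {s..<1} x + h x * indicator {0..<s} x \<partial>lborel)"
    by (rule nn_integral_add[symmetric]) auto
  also have "\<dots> = (\<integral>\<^sup>+ x. h x * indicator {0..<1} x \<partial>lborel)"
    using s by (intro nn_integral_cong) (auto simp: indicator_def)
  finally show ?thesis
    by (simp add: emeasure_circle_measure[OF A] h_def)
qed

lemma distr_circle_rotation:
  assumes "c \<in> circle"
  shows "distr circle_measure circle_measure ((*) c) = circle_measure"
proof (rule measure_eqI)
  fix A assume "A \<in> sets (distr circle_measure circle_measure ((*) c))"
  then have A: "A \<in> sets circle_measure" by simp
  show "emeasure (distr circle_measure circle_measure ((*) c)) A = emeasure circle_measure A"
    using emeasure_circle_rotation[OF assms A]
    by (simp add: emeasure_distr[OF measurable_circle_rotation[OF assms] A] vimage_def Int_def conj_commute)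
qed simp

section \<open>Arguments, roots of unity, and orthogonality of powers on invariant sets\<close>

lemma measurable_Arg2pi [measurable]: "Arg2pi \<in> borel_measurable borel"
  unfolding borel_measurable_iff_le using closed_Arg2pi2pi_le by auto

lemma Arg2pi_cis_mult:
  assumes "0 \<le> s" "s < 2 * pi" "z \<noteq> 0"
  shows "Arg2pi (cis s * z) = Arg2pi z + s \<or> Arg2pi (cis s * z) = Arg2pi z + s - 2 * pi"
proof -
  have "Arg2pi (cis s) = s"
    using assms Arg2pi_exp[of "\<i> * of_real s"] by (simp add: cis_conv_exp)
  then show ?thesis
    using assms Arg2pi_times[of "cis s" z] by (auto simp: add.commute)
qed

text \<open>On the circle \<open>cnj\<close> is inversion, so equality would give two equal powers
  of a primitive \<open>K\<close>-th root of unity with distinct exponents below \<open>K\<close>.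
  This is what kills the off-diagonal moments.\<close>

lemma root_of_unity_power_cnj_neq_1:
  fixes j l K :: nat
  assumes "j < K" "l < K" "j \<noteq> l"
  shows "cis (2 * pi / K) ^ j * cnj (cis (2 * pi / K)) ^ l \<noteq> 1"
proof
  define c where "c = cis (2 * pi / K)"
  assume "cis (2 * pi / K) ^ j * cnj (cis (2 * pi / K)) ^ l = 1"
  then have "c ^ j * cnj c ^ l * c ^ l = c ^ l"
    by (simp add: c_def)
  moreover have "cnj c ^ l * c ^ l = 1"
    by (simp add: c_def cis_cnj cis_mult flip: power_mult_distrib)
  ultimately have "c ^ j = c ^ l"
    by (simp add: mult.assoc)
  moreover have "c ^ i = exp (2 * of_real pi * \<i> * of_nat i / of_nat K)" for i
    unfolding c_def cis_conv_exp exp_of_nat_mult[symmetric] by (rule arg_cong[where f = exp]) simp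
  ultimately have "j mod K = l mod K"
    using assms complex_root_unity_eq[of K j l] by simp
  then show False
    using assms by simp
qed

lemma integrable_circle_bounded:
  fixes g :: "complex \<Rightarrow> 'b :: {banach, second_countable_topology}"
  assumes "g \<in> borel_measurable circle_measure" "\<And>t. t \<in> circle \<Longrightarrow> norm (g t) \<le> C"
  shows "integrable circle_measure g"
proof -
  interpret prob_space circle_measure by (rule prob_space_circle_measure)
  show ?thesis
    by (rule integrable_const_bound[where B = C]) (use assms in auto)
qed

lemma borel_measurable_cnj [measurable]: "cnj \<in> borel_measurable borel"
  by (intro borel_measurable_continuous_onI continuous_intros)

lemma borel_measurable_circleI:
  "g \<in> borel_measurable borel \<Longrightarrow> g \<in> borel_measurable circle_measure"
  unfolding measurable_cong_sets[OF sets_circle_measure refl]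
  by (rule measurable_restrict_space1)

text \<open>Replacing \<open>t\<close> by \<open>c * t\<close> preserves the integral but multiplies
  the integrand by \<open>c ^ j * cnj c ^ l\<close>; a number equal to itself times a factor other
  than 1 is 0.\<close>

lemma integral_circle_moment_eq_0:
  assumes U: "U \<in> sets circle_measure" and c: "c \<in> circle"
    and inv: "\<And>t. t \<in> circle \<Longrightarrow> c * t \<in> U \<longleftrightarrow> t \<in> U"
    and neq: "c ^ j * cnj c ^ l \<noteq> 1"
  shows "(\<integral>t. indicator U t *\<^sub>R (t ^ j * cnj t ^ l) \<partial>circle_measure) = 0"
proof -
  define g :: "complex \<Rightarrow> complex" where "g t = indicator U t *\<^sub>R (t ^ j * cnj t ^ l)" for t
  have [measurable]: "U \<in> sets borel"
    using U unfolding sets_circle_measure_iff by blast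
  have g: "g \<in> borel_measurable circle_measure"
    unfolding g_def by (intro borel_measurable_circleI) measurable
  have "(\<integral>t. g t \<partial>circle_measure) = (\<integral>t. g t \<partial>distr circle_measure circle_measure ((*) c))"
    by (simp add: distr_circle_rotation[OF c])
  also have "\<dots> = (\<integral>t. g (c * t) \<partial>circle_measure)"
    by (rule integral_distr[OF measurable_circle_rotation[OF c] g])
  also have "\<dots> = (\<integral>t. (c ^ j * cnj c ^ l) * g t \<partial>circle_measure)"
    by (intro Bochner_Integration.integral_cong)
       (auto simp: g_def inv indicator_def power_mult_distrib)
  also have "\<dots> = (c ^ j * cnj c ^ l) * (\<integral>t. g t \<partial>circle_measure)"
    by (rule Bochner_Integration.integral_mult_right_zero)
  finally have "(\<integral>t. g t \<partial>circle_measure) = 0"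
    using neq by simp
  then show ?thesis by (simp add: g_def)
qed

text \<open>In the double sum for the squared modulus the off-diagonal moments vanish, and each
  diagonal one is the measure of \<open>U\<close> because \<open>t * cnj t = 1\<close>.\<close>

lemma integral_circle_poly_invariant:
  fixes a :: "nat \<Rightarrow> complex"
  assumes U: "U \<in> sets circle_measure"
    and inv: "\<And>t. t \<in> circle \<Longrightarrow> cis (2 * pi / K) * t \<in> U \<longleftrightarrow> t \<in> U"
  shows "(\<integral>t. indicator U t * (cmod (\<Sum>j<K. a j * t ^ j))\<^sup>2 \<partial>circle_measure)
    = measure circle_measure U * (\<Sum>j<K. (cmod (a j))\<^sup>2)"
proof -
  define h :: "nat \<Rightarrow> nat \<Rightarrow> complex \<Rightarrow> complex"
    where "h j l t = indicator U t *\<^sub>R (t ^ j * cnj t ^ l)" for j l t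
  have [measurable]: "U \<in> sets borel"
    using U unfolding sets_circle_measure_iff by blast
  have int: "integrable circle_measure (h j l)" for j l
    unfolding h_def
    by (rule integrable_circle_bounded[where C = 1], intro borel_measurable_circleI, measurable)
       (auto simp: norm_mult norm_power indicator_def)
  have diag: "(\<integral>t. h j l t \<partial>circle_measure) = (if j = l then measure circle_measure U else 0)"
    if "j < K" "l < K" for j l
  proof (cases "j = l")
    case False
    then show ?thesis
      using integral_circle_moment_eq_0[OF U _ inv root_of_unity_power_cnj_neq_1] that
      by (auto simp: h_def circle_def)
  next
    case True
    have "(\<integral>t. h j l t \<partial>circle_measure) = (\<integral>t. complex_of_real (indicator U t) \<partial>circle_measure)"
      using True
      by (intro Bochner_Integration.integral_cong)
         (auto simp: h_def indicator_def complex_norm_square[symmetric] simp flip: power_mult_distrib)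
    moreover have "U \<inter> circle = U"
      using U unfolding sets_circle_measure_iff by blast
    ultimately show ?thesis
      using True by simp
  qed
  have expand: "complex_of_real (indicator U t * (cmod (\<Sum>j<K. a j * t ^ j))\<^sup>2)
      = (\<Sum>j<K. \<Sum>l<K. (a j * cnj (a l)) * h j l t)" for t
  proof -
    have "complex_of_real ((cmod (\<Sum>j<K. a j * t ^ j))\<^sup>2)
        = (\<Sum>j<K. a j * t ^ j) * (\<Sum>l<K. cnj (a l) * cnj t ^ l)"
      unfolding complex_norm_square by simp
    also have "\<dots> = (\<Sum>j<K. \<Sum>l<K. (a j * cnj (a l)) * (t ^ j * cnj t ^ l))"
      unfolding sum_product by (intro sum.cong refl) (simp only: mult_ac)
    finally show ?thesis
      by (cases "t \<in> U") (simp_all add: h_def)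
  qed
  have "complex_of_real (\<integral>t. indicator U t * (cmod (\<Sum>j<K. a j * t ^ j))\<^sup>2 \<partial>circle_measure)
      = (\<integral>t. complex_of_real (indicator U t * (cmod (\<Sum>j<K. a j * t ^ j))\<^sup>2) \<partial>circle_measure)"
    by (rule integral_complex_of_real[symmetric])
  also have "\<dots> = (\<integral>t. (\<Sum>j<K. \<Sum>l<K. (a j * cnj (a l)) * h j l t) \<partial>circle_measure)"
    by (intro Bochner_Integration.integral_cong refl expand)
  also have "\<dots> = (\<Sum>j<K. \<Sum>l<K. (a j * cnj (a l)) * (\<integral>t. h j l t \<partial>circle_measure))"
    using int by (simp add: integrable_sum integrable_mult_right)
  also have "\<dots> = (\<Sum>j<K. \<Sum>l<K. if j = l then (a j * cnj (a l)) * measure circle_measure U else 0)"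
    by (intro sum.cong refl) (auto simp: diag)
  also have "\<dots> = (\<Sum>j<K. complex_of_real ((cmod (a j))\<^sup>2) * measure circle_measure U)"
    by (intro sum.cong refl) (simp add: complex_norm_square del: of_real_power)
  also have "\<dots> = complex_of_real (measure circle_measure U * (\<Sum>j<K. (cmod (a j))\<^sup>2))"
    by (simp add: sum_distrib_left mult.commute)
  finally show ?thesis
    unfolding of_real_eq_iff .
qed

text \<open>Cauchy-Schwarz. The coefficient sum is the mean of the squared modulus over the circle,
  so the maximum exceeds the mean by a factor of at most \<open>K\<close>; this limits what a small
  set can carry.\<close>

lemma cmod_poly_circle_le:
  fixes a :: "nat \<Rightarrow> complex"
  assumes "t \<in> circle"
  shows "(cmod (\<Sum>j<K. a j * t ^ j))\<^sup>2 \<le> K * (\<Sum>j<K. (cmod (a j))\<^sup>2)"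
proof -
  have "cmod (\<Sum>j<K. a j * t ^ j) \<le> (\<Sum>j<K. cmod (a j))"
    by (rule sum_norm_le) (use assms in \<open>simp add: norm_mult norm_power\<close>)
  then have "(cmod (\<Sum>j<K. a j * t ^ j))\<^sup>2 \<le> (\<Sum>j<K. cmod (a j))\<^sup>2"
    by (intro power_mono) auto
  also have "\<dots> \<le> K * (\<Sum>j<K. (cmod (a j))\<^sup>2)"
    using sum_squared_le_sum_of_squares[of "\<lambda>j. cmod (a j)" "{..<K}"] by (simp add: mult.commute)
  finally show ?thesis .
qed

section \<open>Sectors invariant under the \<open>K\<close>-th roots of unity, and thin norming sets
  inside them\<close>

definition sector :: "nat \<Rightarrow> nat \<Rightarrow> nat \<Rightarrow> complex set" where
  "sector K L l = {t \<in> circle. \<lfloor>real L * (Arg2pi (t ^ K) / (2 * pi))\<rfloor> = int l}"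

lemma sets_sector [measurable]: "sector K L l \<in> sets circle_measure"
proof -
  have "{t. \<lfloor>real L * (Arg2pi (t ^ K) / (2 * pi))\<rfloor> = int l} \<inter> circle \<in> sets borel"
    by (intro sets.Int) (auto simp: circle_def)
  then show ?thesis
    by (auto simp: sector_def sets_circle_measure_iff Int_def conj_commute simp del: sets_circle_measure)
qed

lemma disjoint_family_sector: "disjoint_family (sector K L)"
  by (auto simp: disjoint_family_on_def sector_def)

lemma UN_sector:
  assumes "L > 0"
  shows "(\<Union>l<L. sector K L l) = circle"
proof -
  have "t \<in> (\<Union>l<L. sector K L l)" if "t \<in> circle" for t
  proof -
    define x where "x = Arg2pi (t ^ K) / (2 * pi)"
    have "0 \<le> x" "x < 1"
      using Arg2pi[of "t ^ K"] by (auto simp: x_def)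
    then have "0 \<le> real L * x" "real L * x < real L"
      using assms by auto
    then have "nat \<lfloor>real L * x\<rfloor> < L" "\<lfloor>real L * x\<rfloor> = int (nat \<lfloor>real L * x\<rfloor>)"
      by linarith+
    then show ?thesis
      using that unfolding sector_def x_def by blast
  qed
  then show ?thesis
    by (auto simp: sector_def)
qed

text \<open>A sector depends on \<open>t\<close> only through \<open>t ^ K\<close>, so a factor
  \<open>c\<close> with \<open>c ^ K = 1\<close> drops out. For \<open>K > 0\<close> it consists of
  \<open>K\<close> arcs spread evenly over the circle.\<close>

lemma sector_root_of_unity_mult:
  assumes "c \<in> circle" "c ^ K = 1" "t \<in> circle"
  shows "c * t \<in> sector K L l \<longleftrightarrow> t \<in> sector K L l"
  using assms by (simp add: sector_def power_mult_distrib circle_def norm_mult)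

text \<open>The rotation turns \<open>t ^ K\<close> by one \<open>L\<close>-th of the circle, which
  adds 1 to \<open>L * x\<close> modulo \<open>L\<close>. A wrap-around would need source index
  \<open>L - 1\<close> and target index 0; \<open>Suc l < L\<close> and \<open>Suc l > 0\<close>
  exclude this.\<close>

lemma sector_Suc:
  assumes "K > 0" "Suc l < L" "t \<in> circle"
  shows "cis (2 * pi / (K * L)) * t \<in> sector K L (Suc l) \<longleftrightarrow> t \<in> sector K L l"
proof -
  define c where "c = cis (2 * pi / (K * L))"
  define x where "x = Arg2pi (t ^ K) / (2 * pi)"
  define y where "y = Arg2pi ((c * t) ^ K) / (2 * pi)"
  have cK: "c ^ K = cis (2 * pi / L)"
    unfolding c_def Complex.DeMoivre by (rule arg_cong[where f = cis]) (use assms in \<open>simp add: divide_simps\<close>)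
  have ct: "c * t \<in> circle"
    using assms by (simp add: circle_def norm_mult c_def)
  have "t \<noteq> 0"
    using assms by (auto simp: circle_def)
  moreover have "2 * pi / L < 2 * pi"
    using assms by (simp add: field_simps)
  ultimately have "Arg2pi ((c * t) ^ K) = Arg2pi (t ^ K) + 2 * pi / L \<or>
      Arg2pi ((c * t) ^ K) = Arg2pi (t ^ K) + 2 * pi / L - 2 * pi"
    unfolding power_mult_distrib cK by (intro Arg2pi_cis_mult) auto
  then have "y = x + 1 / L \<or> y = x + 1 / L - 1"
    unfolding x_def y_def by (auto simp: field_simps)
  then have xy: "L * y = L * x + 1 \<or> L * y = L * x + 1 - L"
    using assms by (auto simp: field_simps)
  have "0 \<le> x" "x < 1" "0 \<le> y" "y < 1"
    using Arg2pi[of "t ^ K"] Arg2pi[of "(c * t) ^ K"] by (auto simp: x_def y_def)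
  then have "0 \<le> L * x" "L * x < L" "0 \<le> L * y" "L * y < L"
    using assms by auto
  then have "\<lfloor>L * y\<rfloor> = int (Suc l) \<longleftrightarrow> \<lfloor>L * x\<rfloor> = int l"
    using xy assms(2) by linarith
  then show ?thesis
    using assms ct by (simp add: sector_def x_def y_def c_def)
qed

text \<open>Consecutive sectors are rotations of each other, so the \<open>L\<close> sectors have
  equal measure, and together they partition the circle.\<close>

lemma measure_sector:
  assumes "K > 0" "l < L"
  shows "measure circle_measure (sector K L l) = 1 / L"
proof -
  interpret prob_space circle_measure by (rule prob_space_circle_measure)
  have Suc: "prob (sector K L (Suc l)) = prob (sector K L l)" if "Suc l < L" for l
  proof -
    have "{t \<in> circle. cis (2 * pi / (K * L)) * t \<in> sector K L (Suc l)} = sector K L l"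
      using sector_Suc[OF \<open>K > 0\<close> that] by (auto simp: sector_def)
    then show ?thesis
      using emeasure_circle_rotation[OF _ sets_sector, of "cis (2 * pi / (K * L))" K L "Suc l"]
      by (simp add: circle_def measure_def)
  qed
  have eq: "prob (sector K L i) = prob (sector K L 0)" if "i < L" for i
    using that by (induction i) (auto simp: Suc)
  have "1 = prob (\<Union>i<L. sector K L i)"
    using prob_space assms by (subst UN_sector) auto
  also have "\<dots> = (\<Sum>i<L. prob (sector K L i))"
  proof (rule finite_measure_finite_Union)
    show "sector K L ` {..<L} \<subseteq> events"
      using sets_sector by blast
    show "disjoint_family_on (sector K L) {..<L}"
      using disjoint_family_sector by (auto simp: disjoint_family_on_def)
  qed simp
  also have "\<dots> = (\<Sum>i<L. prob (sector K L 0))"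
    by (intro sum.cong refl eq) simp
  also have "\<dots> = L * prob (sector K L l)"
    by (simp add: eq[OF assms(2)])
  finally show ?thesis
    using assms(2) by (simp add: eq_divide_eq mult.commute)
qed

text \<open>By invariance a whole sector carries exactly the coefficient sum divided by
  \<open>L\<close>. By \<open>cmod_poly_circle_le\<close> its part outside \<open>E\<close> takes at
  most half of that once this part has measure at most \<open>1 / (2 * K * L)\<close>.\<close>

lemma thin_norming_subset:
  assumes E: "E \<in> sets circle_measure"
    and small: "measure circle_measure (circle - E) \<le> 1 / (2 * real K)"
    and K: "K > 0" and L: "L > 0"
  obtains B where "B \<in> sets circle_measure" "B \<subseteq> E" "measure circle_measure B \<le> 1 / real L"
    "\<And>a :: nat \<Rightarrow> complex. (\<Sum>j<K. (cmod (a j))\<^sup>2) / (2 * real L)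
      \<le> (\<integral>t. indicator B t * (cmod (\<Sum>j<K. a j * t ^ j))\<^sup>2 \<partial>circle_measure)"
proof -
  interpret prob_space circle_measure by (rule prob_space_circle_measure)
  \<comment> \<open>Pigeonhole: otherwise the \<open>L\<close> disjoint pieces outside
    \<open>E\<close> would together exceed \<open>1 / (2 * K)\<close>.\<close>
  have "\<exists>l<L. prob (sector K L l - E) \<le> 1 / (2 * real K * real L)"
  proof (rule ccontr)
    assume "\<not> ?thesis"
    then have *: "1 / (2 * real K * real L) < prob (sector K L l - E)" if "l < L" for l
      using that by force
    have "1 / (2 * real K) = (\<Sum>l<L. 1 / (2 * real K * real L))"
      using L by simp
    also have "\<dots> < (\<Sum>l<L. prob (sector K L l - E))"
      by (rule sum_strict_mono) (use * L in auto)
    also have "\<dots> = prob (\<Union>l<L. sector K L l - E)"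
    proof (rule finite_measure_finite_Union[symmetric])
      show "(\<lambda>l. sector K L l - E) ` {..<L} \<subseteq> events"
        using sets_sector E by blast
      show "disjoint_family_on (\<lambda>l. sector K L l - E) {..<L}"
        using disjoint_family_sector[of K L] unfolding disjoint_family_on_def by blast
    qed simp
    also have "(\<Union>l<L. sector K L l - E) = circle - E"
      using UN_sector[OF L, of K] by blast
    finally show False
      using small by simp
  qed
  then obtain l where l: "l < L" and prob_l: "prob (sector K L l - E) \<le> 1 / (2 * real K * real L)"
    by blast
  define U where "U = sector K L l"
  have U: "U \<in> sets circle_measure"
    unfolding U_def by (rule sets_sector)
  have inv: "cis (2 * pi / K) * t \<in> U \<longleftrightarrow> t \<in> U" if "t \<in> circle" for t
    unfolding U_def using K that
    by (intro sector_root_of_unity_mult) (simp_all add: Complex.DeMoivre circle_def)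
  show ?thesis
  proof
    show B: "U \<inter> E \<in> sets circle_measure"
      using U E by blast
    have "prob (U \<inter> E) \<le> prob U"
      using U by (intro finite_measure_mono) auto
    then show "prob (U \<inter> E) \<le> 1 / real L"
      using measure_sector[OF K l] by (simp add: U_def)
    fix a :: "nat \<Rightarrow> complex"
    define P where "P t = (cmod (\<Sum>j<K. a j * t ^ j))\<^sup>2" for t
    define S where "S = (\<Sum>j<K. (cmod (a j))\<^sup>2)"
    have S: "0 \<le> S"
      unfolding S_def by (intro sum_nonneg) auto
    have P: "0 \<le> P t" "t \<in> circle \<Longrightarrow> P t \<le> K * S" for t
      unfolding P_def S_def using cmod_poly_circle_le by auto
    have mP [measurable]: "P \<in> borel_measurable circle_measure"
      unfolding P_def by (intro borel_measurable_circleI) measurable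
    have int: "integrable circle_measure (\<lambda>t. indicator A t * P t)"
      if "A \<in> sets circle_measure" for A
    proof (rule integrable_circle_bounded[where C = "K * S"])
      show "(\<lambda>t. indicator A t * P t) \<in> borel_measurable circle_measure"
        using that by (intro borel_measurable_times borel_measurable_indicator mP)
    qed (use P S in \<open>auto simp: indicator_def\<close>)
    have "1 / real L * S = (\<integral>t. indicator U t * P t \<partial>circle_measure)"
      unfolding P_def S_def using measure_sector[OF K l]
      by (subst integral_circle_poly_invariant[OF U inv]) (simp_all add: U_def)
    also have "\<dots> = (\<integral>t. indicator (U \<inter> E) t * P t + indicator (U - E) t * P t \<partial>circle_measure)"
      by (intro Bochner_Integration.integral_cong) (auto simp: indicator_def)
    also have "\<dots> = (\<integral>t. indicator (U \<inter> E) t * P t \<partial>circle_measure)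
        + (\<integral>t. indicator (U - E) t * P t \<partial>circle_measure)"
      using U E by (intro Bochner_Integration.integral_add int) auto
    also have "(\<integral>t. indicator (U - E) t * P t \<partial>circle_measure)
        \<le> (\<integral>t. indicator (U - E) t * (K * S) \<partial>circle_measure)"
    proof (rule integral_mono)
      show "integrable circle_measure (\<lambda>t. indicator (U - E) t * (K * S))"
        using U E by (intro integrable_mult_left integrable_real_indicator) (auto simp: emeasure_eq_measure)
      show "integrable circle_measure (\<lambda>t. indicator (U - E) t * P t)"
        using U E by (intro int) auto
    qed (use P in \<open>auto simp: indicator_def\<close>)
    also have "\<dots> = prob (U - E) * (K * S)"
    proof -
      have "(U - E) \<inter> circle = U - E"
        using U unfolding sets_circle_measure_iff by blast
      then show ?thesis by simp
    qed
    also have "\<dots> \<le> 1 / (2 * real K * real L) * (K * S)"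
      using prob_l S by (intro mult_right_mono) (auto simp: U_def)
    also have "\<dots> = S / (2 * real L)"
      using K by simp
    finally show "(\<Sum>j<K. (cmod (a j))\<^sup>2) / (2 * real L)
      \<le> (\<integral>t. indicator (U \<inter> E) t * (cmod (\<Sum>j<K. a j * t ^ j))\<^sup>2 \<partial>circle_measure)"
      unfolding P_def[symmetric] S_def[symmetric] by simp
  qed auto
qed

section \<open>Choice of the threshold \<delta> and of the number of sectors; a single block of the
  weight\<close>

lemma (in finite_measure) measure_less_arbitrarily_small:
  fixes f :: "'a \<Rightarrow> real"
  assumes f [measurable]: "f \<in> borel_measurable M" and pos: "AE t in M. f t > 0" and e: "e > 0"
  shows "\<exists>\<delta>>0. measure M {t \<in> space M. f t < \<delta>} < e"
proof -
  define A where "A i = {t \<in> space M. f t < 1 / real (Suc i)}" for i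
  have [measurable]: "A i \<in> sets M" for i
    unfolding A_def by measurable
  have "(\<lambda>i. measure M (A i)) \<longlonglongrightarrow> measure M (\<Inter>i. A i)"
  proof (rule finite_Lim_measure_decseq)
    show "decseq A"
    proof (rule decseq_SucI)
      fix i
      have "1 / real (Suc (Suc i)) \<le> 1 / real (Suc i)"
        by (intro divide_left_mono) auto
      then show "A (Suc i) \<subseteq> A i"
        unfolding A_def by auto
    qed
  qed auto
  moreover have "measure M (\<Inter>i. A i) = 0"
  proof -
    have "AE t in M. t \<notin> (\<Inter>i. A i)"
      using pos
    proof eventually_elim
      fix t assume "f t > 0"
      then obtain i where "1 / real (Suc i) < f t"
        using reals_Archimedean by (auto simp: inverse_eq_divide)
      then show "t \<notin> (\<Inter>i. A i)"
        by (auto simp: A_def intro!: exI[of _ i])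
    qed
    then have "AE t in M. \<not> t \<in> (\<Inter>i. A i)"
      by simp
    then have "(\<Inter>i. A i) \<in> null_sets M"
      by (subst AE_iff_null_sets) auto
    then show ?thesis
      by (rule measure_eq_0_null_sets)
  qed
  ultimately have "eventually (\<lambda>i. measure M (A i) < e) sequentially"
    using e by (auto dest: order_tendstoD)
  then obtain i where "measure M (A i) < e"
    by (auto simp: eventually_sequentially)
  then show ?thesis
    unfolding A_def by (intro exI[of _ "1 / real (Suc i)"]) simp
qed

text \<open>With \<open>c = y\<close> and \<open>L\<close> about \<open>\<delta> * exp y\<close>,
  the height \<open>L / \<delta>\<close> is at most \<open>exp c\<close>, while
  \<open>c ^ k / L\<close> is of order \<open>y ^ k / exp y\<close> and tends to 0.\<close>

lemma exists_nat_log_power_small: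
  fixes \<delta> e :: real
  assumes "\<delta> > 0" "e > 0"
  obtains L :: nat and c :: real where "L > 0" "c \<ge> 1" "real L / \<delta> \<le> exp c" "c ^ k / real L \<le> e"
proof -
  have "((\<lambda>y. y ^ k / exp y) \<longlongrightarrow> (0::real)) at_top"
    by (rule tendsto_power_div_exp_0)
  moreover have "0 < \<delta> * e / 2"
    using assms by simp
  ultimately have "eventually (\<lambda>y::real. y ^ k / exp y < \<delta> * e / 2) at_top"
    by (rule order_tendstoD(2))
  moreover have "eventually (\<lambda>y. exp y \<ge> 2 / \<delta>) at_top"
    using exp_at_top unfolding filterlim_at_top by blast
  moreover have "eventually (\<lambda>y::real. y \<ge> 1) at_top"
    by (rule eventually_ge_at_top)
  ultimately have "eventually (\<lambda>y. y ^ k / exp y < \<delta> * e / 2 \<and> exp y \<ge> 2 / \<delta> \<and> y \<ge> 1) at_top"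
    by eventually_elim simp
  then obtain y where y: "y ^ k / exp y < \<delta> * e / 2" "exp y \<ge> 2 / \<delta>" "y \<ge> 1"
    by (auto simp: eventually_at_top_linorder)
  define L where "L = nat \<lfloor>\<delta> * exp y\<rfloor>"
  \<comment> \<open>This lower bound ensures that the floor loses at most half and that
    \<open>L\<close> is positive.\<close>
  have "\<delta> * exp y \<ge> 2"
    using y(2) assms by (simp add: field_simps)
  then have L: "real L \<le> \<delta> * exp y" "\<delta> * exp y / 2 \<le> real L"
    unfolding L_def by linarith+
  have "L > 0"
    using L(2) \<open>\<delta> * exp y \<ge> 2\<close> by linarith
  have "y ^ k / real L \<le> y ^ k / (\<delta> * exp y / 2)"
    using L(2) y(3) assms by (intro divide_left_mono mult_pos_pos) (auto simp: \<open>L > 0\<close>)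
  also have "\<dots> \<le> e"
    using y(1) assms by (simp add: field_simps)
  finally show ?thesis
    using \<open>L > 0\<close> y(3) L(1) assms by (intro that[of L y]) (auto simp: field_simps)
qed

text \<open>The value \<open>a\<close> is the number of sectors: it cancels the factor
  \<open>1 / L\<close> in the norm on \<open>B\<close>, while the mass that the weight
  \<open>a / f\<close> puts on \<open>B\<close> stays at most 1. The constant \<open>c\<close>
  bounds the logarithm of this weight, and tying its exponent to \<open>k\<close> later serves every
  finite \<open>p\<close> at once.\<close>

lemma exists_norming_block:
  fixes f :: "complex \<Rightarrow> real"
  assumes f: "f \<in> borel_measurable circle_measure"
    and pos: "AE t in circle_measure. f t > 0"
  obtains B a c where "B \<in> sets circle_measure" "a > 0" "c \<ge> 1"
    "measure circle_measure B * c ^ k \<le> (1 / 2) ^ k" "a * measure circle_measure B \<le> 1"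
    "\<And>t. t \<in> B \<Longrightarrow> f t > 0 \<and> a / f t \<le> exp c"
    "\<And>n q. n < M \<Longrightarrow> 1 / 2 \<le>
      a * (\<integral>t. indicator B t * (cmod (t ^ n + (\<Sum>k<n. q k * t ^ k)))\<^sup>2 \<partial>circle_measure)"
proof -
  interpret prob_space circle_measure by (rule prob_space_circle_measure)
  \<comment> \<open>The successor keeps \<open>K\<close> positive even when
    \<open>M = 0\<close>.\<close>
  define K where "K = Suc M"
  obtain \<delta> where \<delta>: "\<delta> > 0" "prob {t \<in> circle. f t < \<delta>} < 1 / (2 * real K)"
    using measure_less_arbitrarily_small[OF f pos, of "1 / (2 * real K)"] by (auto simp: K_def)
  obtain L :: nat and c where L: "L > 0" and c: "c \<ge> 1" "real L / \<delta> \<le> exp c" "c ^ k / real L \<le> (1 / 2) ^ k"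
    using exists_nat_log_power_small[OF \<delta>(1), of "(1 / 2) ^ k" k] by auto
  define E where "E = {t \<in> circle. \<delta> \<le> f t}"
  have E: "E \<in> sets circle_measure"
    using measurable_sets[OF f, of "{\<delta>..}"]
    by (simp add: E_def vimage_def Int_def conj_commute)
  have "circle - E = {t \<in> circle. f t < \<delta>}"
    by (auto simp: E_def)
  then have "prob (circle - E) \<le> 1 / (2 * real K)"
    using \<delta>(2) by simp
  then obtain B where B: "B \<in> sets circle_measure" "B \<subseteq> E" "prob B \<le> 1 / real L"
    "\<And>a :: nat \<Rightarrow> complex. (\<Sum>j<K. (cmod (a j))\<^sup>2) / (2 * real L)
      \<le> (\<integral>t. indicator B t * (cmod (\<Sum>j<K. a j * t ^ j))\<^sup>2 \<partial>circle_measure)"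
    using thin_norming_subset[OF E, of K L] L by (auto simp: K_def)
  show ?thesis
  proof
    show "B \<in> sets circle_measure" "real L > 0" "c \<ge> 1"
      using B L c by auto
    show "real L * prob B \<le> 1"
      using B(3) L by (simp add: field_simps)
    have "prob B * c ^ k \<le> 1 / real L * c ^ k"
      using B(3) c by (intro mult_right_mono) auto
    then show "prob B * c ^ k \<le> (1 / 2) ^ k"
      using c(3) by simp
    show "f t > 0 \<and> real L / f t \<le> exp c" if "t \<in> B" for t
    proof -
      have "\<delta> \<le> f t"
        using that B(2) by (auto simp: E_def)
      moreover from this have "real L / f t \<le> real L / \<delta>"
        using \<delta>(1) by (intro divide_left_mono) auto
      ultimately show ?thesis
        using \<delta>(1) c(2) by linarith
    qed
    show "1 / 2 \<le> real L * (\<integral>t. indicator B t * (cmod (t ^ n + (\<Sum>k<n. q k * t ^ k)))\<^sup>2 \<partial>circle_measure)"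
      if n: "n < M" for n and q :: "nat \<Rightarrow> complex"
    proof -
      \<comment> \<open>Padding with zeros yields \<open>K\<close> coefficients; the leading
        coefficient 1 alone makes their squared sum at least 1.\<close>
      define b where "b j = (if j < n then q j else if j = n then 1 else 0)" for j
      have sub: "{..<Suc n} \<subseteq> {..<K}"
        using n by (auto simp: K_def)
      have poly: "(\<Sum>j<K. b j * t ^ j) = t ^ n + (\<Sum>k<n. q k * t ^ k)" for t
      proof -
        have "(\<Sum>j<K. b j * t ^ j) = (\<Sum>j<Suc n. b j * t ^ j)"
          using sub by (intro sum.mono_neutral_right) (auto simp: b_def)
        then show ?thesis
          by (simp add: b_def)
      qed
      have "(cmod (b n))\<^sup>2 \<le> (\<Sum>j<K. (cmod (b j))\<^sup>2)"
        using n by (intro member_le_sum) (auto simp: K_def)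
      then have "1 / (2 * real L) \<le> (\<Sum>j<K. (cmod (b j))\<^sup>2) / (2 * real L)"
        by (intro divide_right_mono) (auto simp: b_def)
      also have "\<dots> \<le> (\<integral>t. indicator B t * (cmod (t ^ n + (\<Sum>k<n. q k * t ^ k)))\<^sup>2 \<partial>circle_measure)"
        using B(4)[of b] unfolding poly .
      finally show ?thesis
        using L by (simp add: field_simps)
    qed
  qed
qed

text \<open>Polynomials are bounded on the circle and \<rho> is finite, so the Bochner integrals in
  \<open>e_n\<close> agree with the nonnegative ones and none of them is 0 by default.\<close>

lemma e_n_ge:
  assumes \<rho>: "finite_measure \<rho>" "sets \<rho> = sets circle_measure" and C: "C \<ge> 0"
    and ge: "\<And>q. ennreal C \<le> (\<integral>\<^sup>+ t. ennreal ((cmod (t ^ n + (\<Sum>k<n. q k * t ^ k)))\<^sup>2) \<partial>\<rho>)"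
  shows "sqrt C \<le> e_n n \<rho>"
proof -
  interpret finite_measure \<rho> by fact
  have space: "space \<rho> = circle"
    using sets_eq_imp_space_eq[OF \<rho>(2)] by simp
  have "C \<le> (\<integral>t. (cmod (t ^ n + (\<Sum>k<n. q k * t ^ k)))\<^sup>2 \<partial>\<rho>)" for q
  proof -
    have "integrable \<rho> (\<lambda>t. (cmod (t ^ n + (\<Sum>k<n. q k * t ^ k)))\<^sup>2)"
    proof (rule integrable_const_bound[where B = "(1 + (\<Sum>k<n. cmod (q k)))\<^sup>2"])
      show "AE t in \<rho>. norm ((cmod (t ^ n + (\<Sum>k<n. q k * t ^ k)))\<^sup>2) \<le> (1 + (\<Sum>k<n. cmod (q k)))\<^sup>2"
      proof (rule AE_I2)
        fix t assume t: "t \<in> space \<rho>"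
        have "cmod (t ^ n + (\<Sum>k<n. q k * t ^ k)) \<le> cmod (t ^ n) + (\<Sum>k<n. cmod (q k * t ^ k))"
          by (intro norm_triangle_mono norm_sum order_refl)
        also have "\<dots> = 1 + (\<Sum>k<n. cmod (q k))"
          using t by (simp add: space norm_mult norm_power)
        finally show "norm ((cmod (t ^ n + (\<Sum>k<n. q k * t ^ k)))\<^sup>2) \<le> (1 + (\<Sum>k<n. cmod (q k)))\<^sup>2"
          by (simp add: power_mono)
      qed
      show "(\<lambda>t. (cmod (t ^ n + (\<Sum>k<n. q k * t ^ k)))\<^sup>2) \<in> borel_measurable \<rho>"
        unfolding measurable_cong_sets[OF \<rho>(2) refl]
        by (intro borel_measurable_circleI) measurable
    qed
    then have "ennreal C \<le> ennreal (\<integral>t. (cmod (t ^ n + (\<Sum>k<n. q k * t ^ k)))\<^sup>2 \<partial>\<rho>)"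
      using ge[of q] by (simp add: nn_integral_eq_integral)
    then show ?thesis
      by (simp add: ennreal_le_iff)
  qed
  then show ?thesis
    unfolding e_n_def by (intro real_sqrt_le_mono cINF_greatest) auto
qed

lemma ennreal_le_suminf: "g k \<le> (\<Sum>k. g k)" for g :: "nat \<Rightarrow> ennreal"
  using sum_le_suminf[of g "{k}"] by simp

theorem theorem4:
  fixes \<mu> :: "complex measure"
    and f :: "complex \<Rightarrow> real"
    and \<epsilon> :: "nat \<Rightarrow> real"
  assumes f_measurable: "f \<in> borel_measurable circle_measure"
    and \<mu>_density: "\<mu> = density circle_measure (\<lambda>t. ennreal (f t))"
    and \<mu>_finite: "finite_measure \<mu>"
    and f_pos: "AE t in circle_measure. f t > 0"
    and log_divergent: "integral_is_minus_infinity circle_measure (\<lambda>t. ln (f t))"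
    and \<epsilon>_pos: "\<And>n. \<epsilon> n > 0"
    and \<epsilon>_tendsto: "\<epsilon> \<longlonglongrightarrow> 0"
  shows "\<exists>w :: complex \<Rightarrow> real.
           w \<in> borel_measurable circle_measure \<and>
           (\<forall>t\<in>circle. w t > 0) \<and>
           finite_measure (density \<mu> (\<lambda>t. ennreal (w t))) \<and>
           (\<forall>p::real. p > 0 \<longrightarrow> integrable circle_measure (\<lambda>t. \<bar>ln (w t)\<bar> powr p)) \<and>
           filterlim (\<lambda>n. e_n n (density \<mu> (\<lambda>t. ennreal (w t))) / \<epsilon> n) at_top sequentially"
proof -
  interpret prob_space circle_measure by (rule prob_space_circle_measure)
  note [measurable] = f_measurable

  \<comment> \<open>Choice of the degree bounds and of the norming blocks\<close>
  have "\<forall>k. \<exists>N. N \<ge> k \<and> (\<forall>n\<ge>N. \<epsilon> n \<le> (1 / 2) ^ Suc k)"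
  proof
    fix k
    have "eventually (\<lambda>n. \<epsilon> n < (1 / 2) ^ Suc k) sequentially"
      using \<epsilon>_tendsto by (rule order_tendstoD) simp
    then obtain N where "\<And>n. n \<ge> N \<Longrightarrow> \<epsilon> n < (1 / 2) ^ Suc k"
      unfolding eventually_sequentially by blast
    then show "\<exists>N. N \<ge> k \<and> (\<forall>n\<ge>N. \<epsilon> n \<le> (1 / 2) ^ Suc k)"
      by (intro exI[of _ "max k N"]) (auto intro: less_imp_le)
  qed
  \<comment> \<open>The first property makes the bounds exhaust all degrees. The exponent is
    \<open>Suc k\<close> because degrees from \<open>N k\<close> on are to be served by block
    \<open>Suc k\<close>.\<close>
  from choice[OF this] obtain N where N: "\<And>k. N k \<ge> k" "\<And>k n. n \<ge> N k \<Longrightarrow> \<epsilon> n \<le> (1 / 2) ^ Suc k"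
    by blast
  define Q where "Q k B a c \<longleftrightarrow> B \<in> events \<and> a > 0 \<and> c \<ge> 1 \<and>
      prob B * c ^ k \<le> (1 / 2) ^ k \<and> a * prob B \<le> 1 \<and>
      (\<forall>t\<in>B. f t > 0 \<and> a / f t \<le> exp c) \<and>
      (\<forall>n<N k. \<forall>q. 1 / 2 \<le>
        a * (\<integral>t. indicator B t * (cmod (t ^ n + (\<Sum>k<n. q k * t ^ k)))\<^sup>2 \<partial>circle_measure))"
    for k B a and c :: real
  have "\<exists>B a c. Q k B a c" for k
    by (rule exists_norming_block[OF f_measurable f_pos, of k "N k"]) (unfold Q_def, blast)
  then have "\<forall>k. \<exists>x. Q k (fst x) (fst (snd x)) (snd (snd x))"
    by simp
  from choice[OF this] obtain B a c where Q: "\<And>k. Q k (B k) (a k) (c k)"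
    by (metis comp_apply)
  have B [measurable]: "B k \<in> events" and a: "a k > 0" and c: "c k \<ge> 1"
    and Bc: "prob (B k) * c k ^ k \<le> (1 / 2) ^ k" and aB: "a k * prob (B k) \<le> 1"
    and fB: "t \<in> B k \<Longrightarrow> f t > 0" and expc: "t \<in> B k \<Longrightarrow> a k / f t \<le> exp (c k)"
    and norming: "n < N k \<Longrightarrow> 1 / 2 \<le>
      a k * (\<integral>t. indicator (B k) t * (cmod (t ^ n + (\<Sum>k<n. q k * t ^ k)))\<^sup>2 \<partial>circle_measure)"
    for k t n q
    using Q[of k] unfolding Q_def by auto

  \<comment> \<open>The weight and its almost everywhere finiteness\<close>
  define v where "v k t = ennreal ((1 / 2) ^ k * a k / f t) * indicator (B k) t" for k t
  \<comment> \<open>With a supremum instead of a sum, the logarithm is controlled by single blocks;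
    the sum \<open>G\<close> still dominates \<open>W\<close> times \<open>f\<close>.\<close>
  define W where "W t = (SUP k. v k t)" for t
  \<comment> \<open>Where \<open>W\<close> is infinite \<open>enn2real\<close> returns 0, but
    \<open>W_fin\<close> makes this a null set. The lower bound 1 gives positivity and a nonnegative
    logarithm.\<close>
  define w where "w t = max 1 (enn2real (W t))" for t
  define G where "G t = (\<Sum>k. ennreal ((1 / 2) ^ k * a k) * indicator (B k) t)" for t
  have [measurable]: "v k \<in> borel_measurable circle_measure" for k
    unfolding v_def by measurable
  have W_meas [measurable]: "W \<in> borel_measurable circle_measure"
    unfolding W_def by measurable
  have w_meas [measurable]: "w \<in> borel_measurable circle_measure"
    unfolding w_def by measurable
  have G_meas [measurable]: "G \<in> borel_measurable circle_measure"
    unfolding G_def by measurable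
  have w_pos: "w t \<ge> 1" for t
    by (simp add: w_def)

  have vf: "v k t * ennreal (f t) = ennreal ((1 / 2) ^ k * a k) * indicator (B k) t" for k t
    using fB[of t k] a[of k]
    by (auto simp: v_def indicator_def simp flip: ennreal_mult)
  have WG: "W t * ennreal (f t) \<le> G t" for t
  proof -
    have "W t \<le> (\<Sum>k. v k t)"
      unfolding W_def
      by (intro SUP_least ennreal_le_suminf)
    then have "W t * ennreal (f t) \<le> (\<Sum>k. v k t) * ennreal (f t)"
      by (rule mult_right_mono) simp
    also have "\<dots> = (\<Sum>k. v k t * ennreal (f t))"
      by (rule ennreal_suminf_multc[symmetric])
    finally show ?thesis
      by (simp add: vf G_def)
  qed
  have G_fin: "(\<integral>\<^sup>+ t. G t \<partial>circle_measure) < \<infinity>"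
  proof -
    have "(\<integral>\<^sup>+ t. G t \<partial>circle_measure) = (\<Sum>k. ennreal ((1 / 2) ^ k * a k) * emeasure circle_measure (B k))"
      unfolding G_def by (subst nn_integral_suminf) (simp_all only: nn_integral_cmult_indicator[OF B], measurable)
    also have "\<dots> \<le> (\<Sum>k. ennreal ((1 / 2) ^ k))"
    proof (rule suminf_le)
      fix k
      have "ennreal ((1 / 2) ^ k * a k) * emeasure circle_measure (B k) = ennreal ((1 / 2) ^ k * (a k * prob (B k)))"
        using a[of k] by (simp add: emeasure_eq_measure mult.assoc flip: ennreal_mult)
      also have "\<dots> \<le> ennreal ((1 / 2) ^ k)"
        using aB[of k] by (intro ennreal_leI mult_left_le) auto
      finally show "ennreal ((1 / 2) ^ k * a k) * emeasure circle_measure (B k) \<le> ennreal ((1 / 2) ^ k)" .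
    qed auto
    also have "\<dots> = ennreal (\<Sum>k. (1 / 2) ^ k)"
      by (intro suminf_ennreal2) (auto intro: summable_geometric)
    also have "\<dots> < \<infinity>"
      by simp
    finally show ?thesis .
  qed
  have W_fin: "AE t in circle_measure. W t < \<infinity>"
  proof -
    have "AE t in circle_measure. G t \<noteq> \<infinity>"
      using G_fin by (intro nn_integral_PInf_AE) auto
    with f_pos show ?thesis
    proof eventually_elim
      fix t assume "f t > 0" "G t \<noteq> \<infinity>"
      then show "W t < \<infinity>"
        using WG[of t] by (cases "W t = \<infinity>") (auto simp: ennreal_top_mult less_top top_unique)
    qed
  qed

  \<comment> \<open>Finiteness of the weighted measure\<close>
  have emeasure_density_circle:
    "emeasure (density circle_measure g) circle = (\<integral>\<^sup>+ t. g t \<partial>circle_measure)"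
    if "g \<in> borel_measurable circle_measure" for g
    using emeasure_density[OF that sets.top] by (simp cong: nn_integral_cong_simp)
  have f_fin: "(\<integral>\<^sup>+ t. ennreal (f t) \<partial>circle_measure) < \<infinity>"
    using finite_measure.emeasure_finite[OF \<mu>_finite, of "space \<mu>"]
    by (simp add: \<mu>_density emeasure_density_circle less_top)
  have \<rho>: "density \<mu> (\<lambda>t. ennreal (w t)) = density circle_measure (\<lambda>t. ennreal (f t) * ennreal (w t))"
    unfolding \<mu>_density by (rule density_density_eq) auto
  have finite: "finite_measure (density \<mu> (\<lambda>t. ennreal (w t)))"
  proof (rule finite_measureI)
    have "(\<integral>\<^sup>+ t. ennreal (f t) * ennreal (w t) \<partial>circle_measure)
        \<le> (\<integral>\<^sup>+ t. ennreal (f t) + G t \<partial>circle_measure)"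
    proof (rule nn_integral_mono)
      fix t
      have "w t \<le> 1 + enn2real (W t)"
        by (auto simp: w_def)
      then have "ennreal (w t) \<le> 1 + ennreal (enn2real (W t))"
        by (metis ennreal_1 ennreal_leI ennreal_plus enn2real_nonneg zero_le_one)
      also have "ennreal (enn2real (W t)) \<le> W t"
        by (cases "W t") auto
      finally have "ennreal (f t) * ennreal (w t) \<le> ennreal (f t) * (1 + W t)"
        by (intro mult_left_mono) (auto simp: add_left_mono)
      also have "\<dots> \<le> ennreal (f t) + G t"
        using WG[of t] by (simp add: distrib_left mult.commute add_left_mono)
      finally show "ennreal (f t) * ennreal (w t) \<le> ennreal (f t) + G t" .
    qed
    also have "\<dots> < \<infinity>"
      using f_fin G_fin by (simp add: nn_integral_add)
    finally show "emeasure (density \<mu> (\<lambda>t. ennreal (w t))) (space (density \<mu> (\<lambda>t. ennreal (w t)))) \<noteq> \<infinity>"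
      unfolding \<rho> by (simp add: emeasure_density_circle)
  qed

  \<comment> \<open>Integrability of all powers of the logarithm of the weight\<close>
  have Lp: "integrable circle_measure (\<lambda>t. \<bar>ln (w t)\<bar> powr p)" if p: "p > 0" for p :: real
  proof (rule integrableI_bounded)
    \<comment> \<open>Each \<open>c k\<close> with \<open>t\<close> in \<open>B k\<close> is at most
      the \<open>p\<close>-th root of \<open>S t\<close>, hence so is the logarithm of the
      supremum.\<close>
    define S where "S t = (\<Sum>k. ennreal (c k powr p) * indicator (B k) t)" for t
    have le: "ennreal (\<bar>ln (w t)\<bar> powr p) \<le> S t" for t
    proof (cases "S t")
      case top
      then show ?thesis by simp
    next
      case (real s)
      have "W t \<le> ennreal (exp (s powr (1 / p)))"
        unfolding W_def
      proof (rule SUP_least)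
        fix k
        show "v k t \<le> ennreal (exp (s powr (1 / p)))"
        proof (cases "t \<in> B k")
          case False
          then show ?thesis by (simp add: v_def)
        next
          case True
          have "ennreal (c k powr p) * indicator (B k) t \<le> S t"
            unfolding S_def by (rule ennreal_le_suminf)
          then have "c k powr p \<le> s"
            using True real by simp
          then have "(c k powr p) powr (1 / p) \<le> s powr (1 / p)"
            using p by (intro powr_mono2) auto
          then have ck: "c k \<le> s powr (1 / p)"
            using p c[of k] by (simp add: powr_powr)
          have "(1 / 2) ^ k * (a k / f t) \<le> a k / f t"
            using a[of k] fB[OF True] by (intro mult_left_le_one_le) (auto simp: power_le_one)
          also have "\<dots> \<le> exp (s powr (1 / p))"
            using expc[OF True] ck by (meson exp_le_cancel_iff order_trans)
          finally show ?thesis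
            using True by (simp add: v_def)
        qed
      qed
      then have "enn2real (W t) \<le> exp (s powr (1 / p))"
        by (cases "W t") (auto simp: top_unique)
      then have "w t \<le> exp (s powr (1 / p))"
        by (simp add: w_def)
      then have "ln (w t) \<le> s powr (1 / p)"
        using w_pos[of t] ln_le_cancel_iff[of "w t" "exp (s powr (1 / p))"] by simp
      then have "\<bar>ln (w t)\<bar> powr p \<le> (s powr (1 / p)) powr p"
        using w_pos[of t] p by (intro powr_mono2) auto
      then show ?thesis
        using p real by (simp add: powr_powr ennreal_leI)
    qed
    have "(\<integral>\<^sup>+ t. ennreal (norm (\<bar>ln (w t)\<bar> powr p)) \<partial>circle_measure) \<le> (\<integral>\<^sup>+ t. S t \<partial>circle_measure)"
      using le by (intro nn_integral_mono) simp
    also have "\<dots> = (\<Sum>k. ennreal (c k powr p * prob (B k)))"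
      unfolding S_def
      by (subst nn_integral_suminf)
         (simp_all only: nn_integral_cmult_indicator[OF B] emeasure_eq_measure ennreal_mult measure_nonneg powr_ge_zero, measurable)
    also have "\<dots> = ennreal (\<Sum>k. c k powr p * prob (B k))"
    proof (rule suminf_ennreal2)
      show "summable (\<lambda>k. c k powr p * prob (B k))"
      proof (rule summable_comparison_test_ev)
        show "summable (\<lambda>k. (1 / 2 :: real) ^ k)"
          by (rule summable_geometric) simp
        \<comment> \<open>Once \<open>k\<close> reaches \<open>p\<close>, \<open>c k \<ge> 1\<close>
          lets \<open>c k ^ k\<close> replace \<open>c k powr p\<close>, and \<open>Bc\<close> gives
          a geometric bound.\<close>
        have "eventually (\<lambda>k. p \<le> real k) sequentially"
          using filterlim_real_sequentially unfolding filterlim_at_top by blast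
        then show "eventually (\<lambda>k. norm (c k powr p * prob (B k)) \<le> (1 / 2) ^ k) sequentially"
        proof eventually_elim
          fix k assume "p \<le> real k"
          then have "c k powr p \<le> c k powr real k"
            using c[of k] by (intro powr_mono) auto
          also have "\<dots> = c k ^ k"
            using c[of k] by (intro powr_realpow) auto
          finally have "c k powr p * prob (B k) \<le> c k ^ k * prob (B k)"
            by (intro mult_right_mono) auto
          then show "norm (c k powr p * prob (B k)) \<le> (1 / 2) ^ k"
            using Bc[of k] by (simp add: mult.commute)
        qed
      qed
    qed auto
    also have "\<dots> < \<infinity>"
      by simp
    finally show "(\<integral>\<^sup>+ t. ennreal (norm (\<bar>ln (w t)\<bar> powr p)) \<partial>circle_measure) < \<infinity>" .
  qed measurable

  \<comment> \<open>Lower bound for \<open>e_n\<close> from a single block\<close>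
  have lower: "sqrt ((1 / 2) ^ Suc k) \<le> e_n n (density \<mu> (\<lambda>t. ennreal (w t)))" if n: "n < N k" for k n
  proof (rule e_n_ge[OF finite])
    show "sets (density \<mu> (\<lambda>t. ennreal (w t))) = sets circle_measure"
      unfolding \<rho> by (rule sets_density)
    fix q :: "nat \<Rightarrow> complex"
    define P where "P t = (cmod (t ^ n + (\<Sum>k<n. q k * t ^ k)))\<^sup>2" for t
    have P_meas [measurable]: "P \<in> borel_measurable circle_measure"
      unfolding P_def by (intro borel_measurable_circleI) measurable
    have P: "0 \<le> P t" for t
      by (simp add: P_def)
    define I where "I = (\<integral>t. indicator (B k) t * P t \<partial>circle_measure)"
    have "1 / 2 \<le> a k * I"
      using norming[OF n] unfolding I_def P_def .
    \<comment> \<open>A Bochner integral is 0 by default for a non-integrable function, so a nonzero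
      value certifies integrability.\<close>
    then have "I \<noteq> 0"
      by auto
    then have int: "integrable circle_measure (\<lambda>t. indicator (B k) t * P t)"
      unfolding I_def using not_integrable_integral_eq by blast
    have "(1 / 2) ^ Suc k \<le> (1 / 2) ^ k * (a k * I)"
      using mult_left_mono[OF \<open>1 / 2 \<le> a k * I\<close>, of "(1 / 2) ^ k"] by (simp add: mult.commute)
    then have "ennreal ((1 / 2) ^ Suc k) \<le> ennreal ((1 / 2) ^ k * a k * I)"
      by (intro ennreal_leI) (simp add: mult.assoc)
    also have "\<dots> = ennreal ((1 / 2) ^ k * a k) * ennreal I"
      using a[of k] P by (intro ennreal_mult) (auto simp: I_def)
    also have "ennreal I = (\<integral>\<^sup>+ t. ennreal (indicator (B k) t * P t) \<partial>circle_measure)"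
      unfolding I_def using P int by (intro nn_integral_eq_integral[symmetric]) auto
    also have "ennreal ((1 / 2) ^ k * a k) * \<dots>
        = (\<integral>\<^sup>+ t. ennreal ((1 / 2) ^ k * a k) * ennreal (indicator (B k) t * P t) \<partial>circle_measure)"
      by (rule nn_integral_cmult[symmetric]) measurable
    also have "\<dots> \<le> (\<integral>\<^sup>+ t. ennreal (f t) * ennreal (w t) * ennreal (P t) \<partial>circle_measure)"
    proof (rule nn_integral_mono_AE)
      show "AE t in circle_measure. ennreal ((1 / 2) ^ k * a k) * ennreal (indicator (B k) t * P t)
          \<le> ennreal (f t) * ennreal (w t) * ennreal (P t)"
        using W_fin
      proof eventually_elim
        fix t assume "W t < \<infinity>"
        then have "W t = ennreal (enn2real (W t))"
          by simp
        also have "\<dots> \<le> ennreal (w t)"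
          by (intro ennreal_leI) (simp add: w_def)
        finally have "v k t \<le> ennreal (w t)"
          unfolding W_def by (meson SUP_upper UNIV_I order_trans)
        then have "v k t * ennreal (f t) * ennreal (P t) \<le> ennreal (w t) * ennreal (f t) * ennreal (P t)"
          by (intro mult_right_mono) auto
        moreover have "v k t * ennreal (f t) * ennreal (P t) = ennreal ((1 / 2) ^ k * a k) * ennreal (indicator (B k) t * P t)"
          unfolding vf by (auto simp: indicator_def)
        ultimately show "ennreal ((1 / 2) ^ k * a k) * ennreal (indicator (B k) t * P t)
            \<le> ennreal (f t) * ennreal (w t) * ennreal (P t)"
          by (simp add: mult_ac)
      qed
    qed
    also have "\<dots> = (\<integral>\<^sup>+ t. ennreal (P t) \<partial>density \<mu> (\<lambda>t. ennreal (w t)))"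
      unfolding \<rho> by (rule nn_integral_density[symmetric]) measurable
    finally show "ennreal ((1 / 2) ^ Suc k) \<le>
        (\<integral>\<^sup>+ t. ennreal ((cmod (t ^ n + (\<Sum>k<n. q k * t ^ k)))\<^sup>2) \<partial>density \<mu> (\<lambda>t. ennreal (w t)))"
      unfolding P_def .
  qed simp

  \<comment> \<open>Comparison with the given sequence \<epsilon>\<close>
  have ratio: "eventually (\<lambda>n. Z \<le> e_n n (density \<mu> (\<lambda>t. ennreal (w t))) / \<epsilon> n) sequentially" for Z :: real
  proof -
    obtain K where K: "Z < sqrt 2 ^ K"
      using real_arch_pow[of "sqrt 2" Z] by auto
    have "Z \<le> e_n n (density \<mu> (\<lambda>t. ennreal (w t))) / \<epsilon> n" if n: "\<forall>j\<in>{..Suc K}. N j \<le> n" for n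
    proof -
      \<comment> \<open>Minimality gives \<open>N (k - 1) \<le> n\<close> although \<open>N\<close>
        may fail to be monotone. Block \<open>k\<close> bounds \<open>e_n\<close> from below and
        \<open>N (k - 1)\<close> bounds \<open>\<epsilon> n\<close> from above; their quotient is at
        least \<open>sqrt 2 ^ (k - 1)\<close>.\<close>
      define k where "k = (LEAST k. n < N k)"
      have "n < N (Suc n)"
        using N(1)[of "Suc n"] by simp
      then have nk: "n < N k"
        unfolding k_def by (rule LeastI)
      then have "Suc K < k"
        using n by (metis atMost_iff not_le)
      then obtain j where j: "k = Suc j" "K < j"
        by (cases k) auto
      then have "\<not> n < N j"
        using not_less_Least[of j "\<lambda>k. n < N k"] by (simp add: k_def)
      then have "\<epsilon> n \<le> (1 / 2) ^ k"
        using N(2)[of j n] j by simp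
      have "Z \<le> sqrt 2 ^ K"
        using K by simp
      also have "\<dots> \<le> sqrt 2 ^ (k - 1)"
        using j by (intro power_increasing) auto
      also have "\<dots> = sqrt ((1 / 2) ^ Suc k) / (1 / 2) ^ k"
      proof -
        have "sqrt 2 ^ j * (1 / 2) ^ k = sqrt ((1 / 2) ^ Suc k)"
        proof (rule real_sqrt_unique[symmetric])
          have "(sqrt 2 ^ j)\<^sup>2 = ((sqrt 2)\<^sup>2) ^ j"
            by (simp only: power_mult[symmetric] mult.commute)
          also have "\<dots> = 2 ^ j"
            by simp
          finally have "(sqrt 2 ^ j * (1 / 2) ^ k)\<^sup>2 = 2 ^ j * (1 / (2 * 2 ^ j))\<^sup>2"
            by (simp add: power_mult_distrib power_divide j(1))
          then show "(sqrt 2 ^ j * (1 / 2) ^ k)\<^sup>2 = (1 / 2) ^ Suc k"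
            by (simp add: j(1) power2_eq_square power_one_over)
        qed simp
        then show ?thesis
          by (simp add: j eq_divide_eq)
      qed
      also have "\<dots> \<le> sqrt ((1 / 2) ^ Suc k) / \<epsilon> n"
        using \<epsilon>_pos[of n] \<open>\<epsilon> n \<le> (1 / 2) ^ k\<close> by (intro divide_left_mono) auto
      also have "\<dots> \<le> e_n n (density \<mu> (\<lambda>t. ennreal (w t))) / \<epsilon> n"
        using lower[OF nk] \<epsilon>_pos[of n] by (intro divide_right_mono) auto
      finally show ?thesis .
    qed
    moreover have "eventually (\<lambda>n. \<forall>j\<in>{..Suc K}. N j \<le> n) sequentially"
      by (intro eventually_ball_finite ballI eventually_ge_at_top) simp
    ultimately show ?thesis
      by (auto elim: eventually_mono)
  qed
  show ?thesis
  proof (intro exI[of _ w] conjI allI impI ballI)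
    show "0 < w t" for t
      using w_pos[of t] by simp
    show "filterlim (\<lambda>n. e_n n (density \<mu> (\<lambda>t. ennreal (w t))) / \<epsilon> n) at_top sequentially"
      unfolding filterlim_at_top using ratio by blast
  qed (use w_meas finite Lp in auto)
qed

end
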